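(* Let $X$ be a pseudocompact Tychonoff space. Then $B_1(X)$ is locally complete if, and only if, $\beta X$ is scattered. In particular, for a compact Hausdorff space $K$, the following are equivalent: $B_1(K)$ is locally complete; $B_1(K)$ is sequentially complete; $K$ is scattered.
   Context: All topological spaces are Tychonoff. $B_1(X)$ is the space of all functions $f:X\to\mathbb{R}$ that are pointwise limits of sequences of continuous real-valued functions on $X$, a real locally convex space with the pointwise topology (subspace topology from $\mathbb{R}^X$). A Hausdorff locally convex space $E$ is sequentially complete if each Cauchy sequence in $E$ converges, and locally complete if the closed absolutely convex hull of every null sequence in $E$ is compact. $\beta X$ denotes the Stone–Čech compactification of $X$. A space is pseudocompact if every continuous real-valued function on it is bounded. A space is scattered if every nonempty subspace of it has an isolated point. *)

theory Defs
  imports "HOL-Analysis.Analysis" "HOL-Library.Function_Algebras"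
begin

subsection \<open>Locally convex spaces\<close>

instantiation "fun" :: (type, real_vector) real_vector
begin

definition scaleR_fun_def: "c *\<^sub>R f = (\<lambda>x. c *\<^sub>R f x)"

instance
  by standard (simp_all add: scaleR_fun_def fun_eq_iff scaleR_add_right scaleR_add_left)

end

lemma scaleR_fun_apply [simp]: "(c *\<^sub>R f) x = c *\<^sub>R f x"
  by (simp add: scaleR_fun_def)

text \<open>
  A locally convex space \<open>E\<close> is a topology whose carrier \<open>topspace E\<close> is a linear subspace of the
  ambient real vector space; closures, limits and compactness are always taken in \<open>E\<close>.
\<close>

definition hausdorff_lcs :: "'v::real_vector topology \<Rightarrow> bool" where
  "hausdorff_lcs E \<longleftrightarrow>
     subspace (topspace E) \<and> Hausdorff_space E \<and>
     continuous_map (prod_topology E E) E (\<lambda>(x, y). x + y) \<and>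
     continuous_map (prod_topology euclideanreal E) E (\<lambda>(c, x). c *\<^sub>R x) \<and>
     (\<forall>U. openin E U \<and> 0 \<in> U \<longrightarrow> (\<exists>V. openin E V \<and> 0 \<in> V \<and> convex V \<and> V \<subseteq> U))"

definition cauchy_seq_in :: "'v::real_vector topology \<Rightarrow> (nat \<Rightarrow> 'v) \<Rightarrow> bool" where
  "cauchy_seq_in E s \<longleftrightarrow>
     range s \<subseteq> topspace E \<and>
     (\<forall>U. openin E U \<and> 0 \<in> U \<longrightarrow> (\<exists>N. \<forall>m\<ge>N. \<forall>n\<ge>N. s m - s n \<in> U))"

definition sequentially_complete :: "'v::real_vector topology \<Rightarrow> bool" where
  "sequentially_complete E \<longleftrightarrow>
     (\<forall>s. cauchy_seq_in E s \<longrightarrow> (\<exists>l. limitin E s l sequentially))"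

definition absolutely_convex :: "'v::real_vector set \<Rightarrow> bool" where
  "absolutely_convex S \<longleftrightarrow>
     (\<forall>x\<in>S. \<forall>y\<in>S. \<forall>a b. \<bar>a\<bar> + \<bar>b\<bar> \<le> 1 \<longrightarrow> a *\<^sub>R x + b *\<^sub>R y \<in> S)"

definition locally_complete :: "'v::real_vector topology \<Rightarrow> bool" where
  "locally_complete E \<longleftrightarrow>
     (\<forall>s. range s \<subseteq> topspace E \<and> limitin E s 0 sequentially \<longrightarrow>
        compactin E (E closure_of (absolutely_convex hull (range s))))"


subsection \<open>Topological notions\<close>

definition tychonoff_space :: "'a topology \<Rightarrow> bool" where
  "tychonoff_space X \<longleftrightarrow> completely_regular_space X \<and> Hausdorff_space X"

definition pseudocompact_space :: "'a topology \<Rightarrow> bool" where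
  "pseudocompact_space X \<longleftrightarrow>
     (\<forall>f. continuous_map X euclideanreal f \<longrightarrow> bounded (f ` topspace X))"

definition scattered_space :: "'a topology \<Rightarrow> bool" where
  "scattered_space X \<longleftrightarrow>
     (\<forall>S. S \<subseteq> topspace X \<and> S \<noteq> {} \<longrightarrow> (\<exists>x\<in>S. openin (subtopology X S) {x}))"

text \<open>
  The Stone--Cech compactification is the closure of the image of \<open>X\<close> under the evaluation map
  into the cube \<open>[0,1]\<close> to the power \<open>C(X,[0,1])\<close>. Functions are taken in \<open>extensional (topspace X)\<close>
  so that each continuous function on the carrier is counted once.
\<close>

definition unit_functions :: "'a topology \<Rightarrow> ('a \<Rightarrow> real) set" where
  "unit_functions X =
     {f \<in> extensional (topspace X). continuous_map X (top_of_set {0..1}) f}"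

definition unit_cube :: "'a topology \<Rightarrow> (('a \<Rightarrow> real) \<Rightarrow> real) topology" where
  "unit_cube X = product_topology (\<lambda>_. top_of_set {0..1}) (unit_functions X)"

definition stone_cech :: "'a topology \<Rightarrow> (('a \<Rightarrow> real) \<Rightarrow> real) topology" where
  "stone_cech X =
     subtopology (unit_cube X)
       (unit_cube X closure_of ((\<lambda>x. \<lambda>f\<in>unit_functions X. f x) ` topspace X))"


subsection \<open>Functions of the first Baire class\<close>

text \<open>
  Real functions on \<open>X\<close> are encoded as total functions vanishing off \<open>topspace X\<close>, so that
  they form a linear subspace. The coordinates outside \<open>topspace X\<close> are then constantly \<open>0\<close>
  and do not contribute to the topology, which is thus that of pointwise convergence on \<open>X\<close>.
\<close>

definition baire1_functions :: "'a topology \<Rightarrow> ('a \<Rightarrow> real) set" where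
  "baire1_functions X =
     {f. (\<forall>x. x \<notin> topspace X \<longrightarrow> f x = 0) \<and>
         (\<exists>g::nat \<Rightarrow> 'a \<Rightarrow> real. (\<forall>n. continuous_map X euclideanreal (g n)) \<and>
              (\<forall>x\<in>topspace X. (\<lambda>n. g n x) \<longlonglongrightarrow> f x))}"

definition baire1_space :: "'a topology \<Rightarrow> ('a \<Rightarrow> real) topology" where
  "baire1_space X = subtopology (powertop_real UNIV) (baire1_functions X)"

lemma topspace_baire1_space [simp]: "topspace (baire1_space X) = baire1_functions X"
  by (simp add: baire1_space_def)

lemma subspace_baire1_functions: "subspace (baire1_functions X)"
  unfolding subspace_def
proof (intro conjI ballI allI)
  show "0 \<in> baire1_functions X"
    by (auto simp: baire1_functions_def intro!: exI[of _ "\<lambda>_ _. 0"])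
next
  fix f h assume "f \<in> baire1_functions X" "h \<in> baire1_functions X"
  then obtain g k :: "nat \<Rightarrow> 'a \<Rightarrow> real" where
    "\<And>n. continuous_map X euclideanreal (g n)" "\<And>n. continuous_map X euclideanreal (k n)"
    "\<And>x. x \<in> topspace X \<Longrightarrow> (\<lambda>n. g n x) \<longlonglongrightarrow> f x" "\<And>x. x \<in> topspace X \<Longrightarrow> (\<lambda>n. k n x) \<longlonglongrightarrow> h x"
    "\<And>x. x \<notin> topspace X \<Longrightarrow> f x = 0" "\<And>x. x \<notin> topspace X \<Longrightarrow> h x = 0"
    unfolding baire1_functions_def by blast
  then show "f + h \<in> baire1_functions X"
    unfolding baire1_functions_def
    by (auto intro!: exI[of _ "\<lambda>n x. g n x + k n x"] continuous_map_add tendsto_add)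
next
  fix c f assume "f \<in> baire1_functions X"
  then obtain g :: "nat \<Rightarrow> 'a \<Rightarrow> real" where
    "\<And>n. continuous_map X euclideanreal (g n)"
    "\<And>x. x \<in> topspace X \<Longrightarrow> (\<lambda>n. g n x) \<longlonglongrightarrow> f x" "\<And>x. x \<notin> topspace X \<Longrightarrow> f x = 0"
    unfolding baire1_functions_def by blast
  then show "c *\<^sub>R f \<in> baire1_functions X"
    unfolding baire1_functions_def
    by (auto intro!: exI[of _ "\<lambda>n x. c * g n x"] continuous_map_real_mult tendsto_mult)
qed

lemma hausdorff_lcs_baire1_space: "hausdorff_lcs (baire1_space X)"
  unfolding hausdorff_lcs_def
proof (intro conjI allI impI)
  let ?E = "baire1_space X"
  have pr: "continuous_map ?E euclideanreal (\<lambda>f. f i)" for i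
    unfolding baire1_space_def
    by (intro continuous_map_from_subtopology continuous_map_product_projection) simp
  show sub: "subspace (topspace ?E)"
    by (simp add: subspace_baire1_functions)
  show "Hausdorff_space ?E"
    unfolding baire1_space_def
    by (intro Hausdorff_space_subtopology) (simp add: Hausdorff_space_product_topology)
  show "continuous_map (prod_topology ?E ?E) ?E (\<lambda>(x, y). x + y)"
    unfolding baire1_space_def[of X, THEN arg_cong, of "\<lambda>E. continuous_map _ E _"]
      continuous_map_in_subtopology
  proof
    show "continuous_map (prod_topology ?E ?E) (powertop_real UNIV) (\<lambda>(x, y). x + y)"
      unfolding continuous_map_componentwise_UNIV case_prod_unfold plus_fun_apply
      by (intro allI continuous_map_add continuous_map_compose[OF continuous_map_fst pr, unfolded o_def]
          continuous_map_compose[OF continuous_map_snd pr, unfolded o_def])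
    show "(\<lambda>(x, y). x + y) \<in> topspace (prod_topology ?E ?E) \<rightarrow> baire1_functions X"
      using subspace_baire1_functions[of X] by (auto simp: subspace_add)
  qed
  show "continuous_map (prod_topology euclideanreal ?E) ?E (\<lambda>(c, x). c *\<^sub>R x)"
    unfolding baire1_space_def[of X, THEN arg_cong, of "\<lambda>E. continuous_map _ E _"]
      continuous_map_in_subtopology
  proof
    show "continuous_map (prod_topology euclideanreal ?E) (powertop_real UNIV) (\<lambda>(c, x). c *\<^sub>R x)"
      unfolding continuous_map_componentwise_UNIV case_prod_unfold scaleR_fun_apply real_scaleR_def
      by (intro allI continuous_map_real_mult continuous_map_fst
          continuous_map_compose[OF continuous_map_snd pr, unfolded o_def])
    show "(\<lambda>(c, x). c *\<^sub>R x) \<in> topspace (prod_topology euclideanreal ?E) \<rightarrow> baire1_functions X"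
      using subspace_baire1_functions[of X] by (auto simp: subspace_scale)
  qed
  fix U assume "openin ?E U \<and> 0 \<in> U"
  then obtain W where W: "openin (powertop_real UNIV) W" "U = W \<inter> baire1_functions X" "0 \<in> W"
    by (auto simp: baire1_space_def openin_subtopology)
  obtain Y where Y: "0 \<in> Pi\<^sub>E UNIV Y" "\<And>i. openin euclideanreal (Y i)"
      "finite {i. Y i \<noteq> topspace euclideanreal}" "Pi\<^sub>E UNIV Y \<subseteq> W"
    using product_topology_open_contains_basis[OF W(1,3)] by blast
  have "\<exists>e>0. ball (0::real) e \<subseteq> Y i" for i
    using Y(1) Y(2)[of i] by (auto simp: PiE_iff open_contains_ball)
  then obtain e where e: "\<And>i. e i > 0" "\<And>i. ball (0::real) (e i) \<subseteq> Y i"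
    by metis
  define Z where "Z i = (if Y i = UNIV then UNIV else ball (0::real) (e i))" for i
  have "Z i \<subseteq> Y i" "0 \<in> Z i" for i
    using e by (auto simp: Z_def)
  then have Z: "Pi\<^sub>E UNIV Z \<subseteq> Pi\<^sub>E UNIV Y" "0 \<in> Pi\<^sub>E UNIV Z"
    by (auto simp: PiE_iff)
  have "finite {i. Z i \<noteq> UNIV}"
    by (rule finite_subset[OF _ Y(3)]) (auto simp: Z_def)
  then have "openin (powertop_real UNIV) (Pi\<^sub>E UNIV Z)"
    by (intro product_topology_basis) (auto simp: Z_def)
  moreover have "convex (Pi\<^sub>E UNIV Z)"
  proof (rule convexI)
    fix x y and u v :: real
    assume *: "x \<in> Pi\<^sub>E UNIV Z" "y \<in> Pi\<^sub>E UNIV Z" "0 \<le> u" "0 \<le> v" "u + v = 1"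
    have "convex (Z i)" for i
      by (simp add: Z_def)
    then show "u *\<^sub>R x + v *\<^sub>R y \<in> Pi\<^sub>E UNIV Z"
      using * convexD[of "Z _" "x _" "y _" u v] by (auto simp: PiE_iff)
  qed
  moreover have "convex (baire1_functions X)" "0 \<in> baire1_functions X"
    using subspace_baire1_functions by (auto intro: subspace_imp_convex subspace_0)
  ultimately show "\<exists>V. openin ?E V \<and> 0 \<in> V \<and> convex V \<and> V \<subseteq> U"
    using Z W Y(4)
    by (intro exI[of _ "Pi\<^sub>E UNIV Z \<inter> baire1_functions X"])
       (auto simp: baire1_space_def openin_subtopology convex_Int)
qed

end

(*
  If Z is compact, scattered and F : Z -> R^N is continuous, then the points without a neighbourhood
  of countable image form a closed set that has no isolated point; hence F(Z) is countable. Countably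
  many Baire-one functions on X depend only on countably many continuous functions, that is, on
  such an F on the Stone-Cech compactification, and an arbitrary function that factors through a
  countable F(X) is a pointwise limit of Newton interpolation polynomials. So B_1(X) is closed under
  pointwise limits of sequences, and a null sequence has its closed absolutely convex hull inside
  the compact image of the unit ball of l^1.

  If Z is compact and not scattered, a dyadic scheme over a subset without isolated points gives
  f : Z -> R whose image contains [0,1], and by pseudocompactness the same holds for f on X. Local
  completeness, applied to the null sequence of the functions 2^(n+1) on the fibre of f over the n-th
  rational and 0 elsewhere, makes the indicator of the preimage of the rationals Baire-one. As zero
  sets of a pseudocompact X have closed images in R, the irrationals of [0,1] would then be an F_sigma,
  against the Baire category theorem.
*)

theory Submission
  imports Defs
begin

subsection \<open>Real functions on pseudocompact spaces\<close>

lemma continuous_map_suminf: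
  fixes u :: "nat \<Rightarrow> 'a \<Rightarrow> real"
  assumes "\<And>n. continuous_map X euclideanreal (u n)"
    and "\<And>n x. x \<in> topspace X \<Longrightarrow> \<bar>u n x\<bar> \<le> M n" and "summable M"
  shows "continuous_map X euclideanreal (\<lambda>x. \<Sum>n. u n x)"
proof -
  have lim: "uniform_limit (topspace X) (\<lambda>n x. \<Sum>i<n. u i x) (\<lambda>x. \<Sum>n. u n x) sequentially"
    by (rule Weierstrass_m_test[of _ u M]) (use assms in auto)
  have "continuous_map X Met_TC.mtopology (\<lambda>x. \<Sum>n. u n x)"
  proof (rule Met_TC.continuous_map_uniform_limit)
    show "\<forall>\<^sub>F n in sequentially. continuous_map X Met_TC.mtopology (\<lambda>x. \<Sum>i<n. u i x)"
      using assms(1) by (auto intro!: always_eventually continuous_map_sum)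
  qed (use lim in \<open>auto simp: uniform_limit_iff\<close>)
  then show ?thesis
    by simp
qed

text \<open>The reciprocal of \<open>f\<close> is continuous, hence bounded. This substitutes for
  compactness in every later argument on a pseudocompact space.\<close>

lemma pseudocompact_space_bounded_below:
  assumes "pseudocompact_space X" "continuous_map X euclideanreal f"
    and pos: "\<And>x. x \<in> topspace X \<Longrightarrow> f x > 0"
  shows "\<exists>d>0. \<forall>x\<in>topspace X. d \<le> f x"
proof -
  have "continuous_map X euclideanreal (\<lambda>x. inverse (f x))"
    using assms(2) pos by (intro continuous_map_real_inverse) force+
  then obtain B where B: "B > 0" "\<And>x. x \<in> topspace X \<Longrightarrow> \<bar>inverse (f x)\<bar> \<le> B"
    using assms(1) by (auto simp: pseudocompact_space_def bounded_pos)
  have "inverse B \<le> f x" if "x \<in> topspace X" for x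
    using le_imp_inverse_le[of "inverse (f x)" B] B(2)[OF that] pos[OF that] by simp
  with B(1) show ?thesis
    by (intro exI[of _ "inverse B"]) auto
qed

text \<open>If \<open>p\<close> is not attained on the zero set, then
  \<open>\<bar>f x - p\<bar> + g x\<close> is positive on all of \<open>X\<close>, hence bounded
  away from 0; on the zero set this bound is a distance from \<open>p\<close>.\<close>

lemma closed_image_zero_set:
  assumes "pseudocompact_space X" and f: "continuous_map X euclideanreal f"
    and g: "continuous_map X euclideanreal g" and nonneg: "\<And>x. x \<in> topspace X \<Longrightarrow> 0 \<le> g x"
  shows "closed (f ` {x \<in> topspace X. g x = (0::real)})" (is "closed ?C")
proof -
  have "p \<in> ?C" if p: "p \<in> closure ?C" for p :: real
  proof (rule ccontr)
    assume np: "p \<notin> ?C"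
    have pos: "0 < \<bar>f x - p\<bar> + g x" if "x \<in> topspace X" for x
    proof (cases "g x = 0")
      case True
      then have "f x \<noteq> p"
        using np that by blast
      then show ?thesis
        using True by simp
    next
      case False
      then show ?thesis
        using nonneg[OF that] by linarith
    qed
    have "continuous_map X euclideanreal (\<lambda>x. \<bar>f x - p\<bar> + g x)"
      by (intro continuous_intros f g) simp
    then obtain d where d: "d > 0" "\<And>x. x \<in> topspace X \<Longrightarrow> d \<le> \<bar>f x - p\<bar> + g x"
      using pseudocompact_space_bounded_below[of X "\<lambda>x. \<bar>f x - p\<bar> + g x"] assms(1) pos
      by blast
    obtain x where x: "x \<in> topspace X" "g x = 0" "dist (f x) p < d"
      using p d(1) unfolding closure_approachable by blast
    then show False
      using d(2)[OF x(1)] by (simp add: dist_real_def)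
  qed
  then have "closure ?C \<subseteq> ?C"
    by (rule subsetI)
  then show ?thesis
    by (simp only: closure_subset_eq)
qed

lemma compact_imp_pseudocompact_space:
  assumes "compact_space X"
  shows "pseudocompact_space X"
  using assms image_compactin[of X "topspace X" euclideanreal] compact_imp_bounded
  by (auto simp: pseudocompact_space_def compact_space_def)


subsection \<open>Surjections of non-scattered compact spaces onto the unit interval\<close>

text \<open>
  The sum of the increments \<open>v / 2 ^ Suc n\<close> of \<open>hits_dyadics_refine\<close> has dense image in \<open>[0,1]\<close>: refining splits
  each open set where \<open>f = k / 2 ^ n\<close> into two on which the values are \<open>2k / 2 ^ Suc n\<close> and
  \<open>(2k + 1) / 2 ^ Suc n\<close>.
\<close>

definition hits_dyadics :: "'a topology \<Rightarrow> 'a set \<Rightarrow> nat \<Rightarrow> ('a \<Rightarrow> real) \<Rightarrow> bool" where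
  "hits_dyadics Z S n f \<longleftrightarrow>
     (\<forall>k<2^n. \<exists>U. openin Z U \<and> U \<inter> S \<noteq> {} \<and> (\<forall>x\<in>U. f x = real k / 2^n))"

text \<open>Since no point of \<open>S\<close> is isolated, each \<open>U k\<close> contains two
  distinct points of \<open>S\<close>. A single Urysohn function separates all the chosen first
  points from all the second ones.\<close>

lemma hits_dyadics_refine:
  assumes "compact_space Z" "Hausdorff_space Z" "S \<subseteq> topspace Z"
    and perfect: "\<And>x. x \<in> S \<Longrightarrow> \<not> openin (subtopology Z S) {x}"
    and f: "hits_dyadics Z S n f"
  obtains v where "continuous_map Z euclideanreal v" "\<And>x. v x \<in> {0..1}"
    "hits_dyadics Z S (Suc n) (\<lambda>x. f x + v x / 2 ^ Suc n)"
proof -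
  obtain U where U: "\<And>k. k < 2^n \<Longrightarrow> openin Z (U k)" "\<And>k. k < 2^n \<Longrightarrow> U k \<inter> S \<noteq> {}"
      "\<And>k x. k < 2^n \<Longrightarrow> x \<in> U k \<Longrightarrow> f x = real k / 2^n"
    using f unfolding hits_dyadics_def by metis
  have "\<exists>a b. a \<in> U k \<inter> S \<and> b \<in> U k \<inter> S \<and> a \<noteq> b" if k: "k < 2^n" for k
  proof -
    obtain a where a: "a \<in> U k \<inter> S"
      using U(2)[OF k] by blast
    moreover have "openin (subtopology Z S) (U k \<inter> S)"
      using U(1)[OF k] by (auto simp: openin_subtopology)
    ultimately have "U k \<inter> S \<noteq> {a}"
      using perfect by auto
    with a show ?thesis
      by blast
  qed
  then obtain a b where ab: "\<And>k. k < 2^n \<Longrightarrow> a k \<in> U k \<inter> S"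
      "\<And>k. k < 2^n \<Longrightarrow> b k \<in> U k \<inter> S" "\<And>k. k < 2^n \<Longrightarrow> a k \<noteq> b k"
    by metis
  \<comment> \<open>Points chosen for different indices differ because \<open>f\<close> takes
    different values there.\<close>
  have disj: "disjnt (a ` {..<2^n}) (b ` {..<2^n})"
  proof -
    have False if "k < 2^n" "l < 2^n" "a k = b l" for k l
    proof -
      have "real k / 2^n = real l / 2^n"
        using U(3)[of k "a k"] U(3)[of l "b l"] ab(1)[of k] ab(2)[of l] that by simp
      then show False
        using ab(3)[of k] that by simp
    qed
    then show ?thesis
      by (fastforce simp: disjnt_iff)
  qed
  have closed: "closedin Z (c ` {..<2^n})" if "\<And>k. k < 2^n \<Longrightarrow> c k \<in> U k \<inter> S"
    for c :: "nat \<Rightarrow> 'a"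
    using that assms(2,3)
    by (intro closedin_Hausdorff_finite) auto
  have "normal_space Z"
    using assms(1,2) compact_Hausdorff_or_regular_imp_normal_space by blast
  then obtain w where w: "continuous_map Z (top_of_set {0..1}) w"
      "w ` (a ` {..<2^n}) \<subseteq> {0::real}" "w ` (b ` {..<2^n}) \<subseteq> {1}"
    using Urysohn_lemma[of Z "a ` {..<2^n}" "b ` {..<2^n}" "0::real" 1] closed[of a] closed[of b]
      ab(1,2) disj by force
  then have wc: "continuous_map Z euclideanreal w"
    by (simp add: continuous_map_in_subtopology)
  \<comment> \<open>\<open>w\<close> is known only at the chosen points. Stretching and truncating
    it makes \<open>v\<close> equal to 0 on the open set \<open>w < 1/3\<close> and to 1 on
    \<open>w > 2/3\<close>, as \<open>hits_dyadics\<close> asks for constant values on open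
    sets.\<close>
  define v where "v x = max 0 (min 1 (3 * w x - 1))" for x
  show thesis
  proof
    show "continuous_map Z euclideanreal v"
      unfolding v_def by (intro continuous_intros wc) auto
    show "v x \<in> {0..1}" for x
      by (auto simp: v_def)
    show "hits_dyadics Z S (Suc n) (\<lambda>x. f x + v x / 2 ^ Suc n)"
      unfolding hits_dyadics_def
    proof (intro allI impI)
      fix j :: nat assume j: "j < 2 ^ Suc n"
      define k where "k = j div 2"
      have k: "k < 2^n"
        using j by (auto simp: k_def)
      show "\<exists>V. openin Z V \<and> V \<inter> S \<noteq> {} \<and>
              (\<forall>x\<in>V. f x + v x / 2 ^ Suc n = real j / 2 ^ Suc n)"
      proof (cases "even j")
        case True
        then have jk: "j = 2 * k"
          by (simp add: k_def)
        let ?V = "U k \<inter> {x \<in> topspace Z. w x \<in> {..<1/3}}"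
        have "openin Z ?V"
          using U(1)[OF k] openin_continuous_map_preimage[OF wc, of "{..<1/3}"] by (intro openin_Int) auto
        moreover have "a k \<in> ?V \<inter> S"
          using ab(1)[OF k] w(2) k assms(3) by (auto simp: image_subset_iff)
        moreover have "f x + v x / 2 ^ Suc n = real j / 2 ^ Suc n" if "x \<in> ?V" for x
          using that U(3)[OF k, of x] by (auto simp: v_def jk field_simps)
        ultimately show ?thesis
          by blast
      next
        case False
        then have jk: "j = 2 * k + 1"
          by (simp add: k_def)
        let ?V = "U k \<inter> {x \<in> topspace Z. w x \<in> {2/3<..}}"
        have "openin Z ?V"
          using U(1)[OF k] openin_continuous_map_preimage[OF wc, of "{2/3<..}"] by (intro openin_Int) auto
        moreover have "b k \<in> ?V \<inter> S"
          using ab(2)[OF k] w(3) k assms(3) by (auto simp: image_subset_iff)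
        moreover have "f x + v x / 2 ^ Suc n = real j / 2 ^ Suc n" if "x \<in> ?V" for x
          using that U(3)[OF k, of x] by (auto simp: v_def jk field_simps)
        ultimately show ?thesis
          by blast
      qed
    qed
  qed
qed

text \<open>The refinements converge uniformly, so the limit is continuous. Its image is compact and
  comes arbitrarily close to every point of \<open>{0..<1}\<close>.\<close>

proposition non_scattered_onto_unit_interval:
  assumes "compact_space Z" "Hausdorff_space Z" "\<not> scattered_space Z"
  obtains f :: "'a \<Rightarrow> real" where "continuous_map Z euclideanreal f" "{0..1} \<subseteq> f ` topspace Z"
proof -
  obtain S where S: "S \<subseteq> topspace Z" "S \<noteq> {}" "\<And>x. x \<in> S \<Longrightarrow> \<not> openin (subtopology Z S) {x}"
    using assms(3) unfolding scattered_space_def by blast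
  \<comment> \<open>The clause for \<open>n = 0\<close> pins the start of the recursion, so that
    each \<open>F n\<close> is exactly the partial sum of the increments.\<close>
  define Q where "Q n f \<longleftrightarrow> hits_dyadics Z S n f \<and> (n = 0 \<longrightarrow> f = (\<lambda>_. 0))"
    for n and f :: "'a \<Rightarrow> real"
  define R where "R n f g \<longleftrightarrow> (\<exists>v. continuous_map Z euclideanreal v \<and> (\<forall>x. v x \<in> {0..1}) \<and>
      g = (\<lambda>x. f x + v x / 2 ^ Suc n))" for n and f g :: "'a \<Rightarrow> real"
  have "\<exists>F. \<forall>n. Q n (F n) \<and> R n (F n) (F (Suc n))"
  proof (rule dependent_nat_choice)
    show "\<exists>f. Q 0 f"
      using S(1,2) by (auto simp: Q_def hits_dyadics_def intro!: exI[of _ "topspace Z"])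
    show "\<exists>g. Q (Suc n) g \<and> R n f g" if "Q n f" for n f
    proof -
      have "hits_dyadics Z S n f"
        using that by (simp add: Q_def)
      then obtain v where "continuous_map Z euclideanreal v" "\<And>x. v x \<in> {0..1}"
          "hits_dyadics Z S (Suc n) (\<lambda>x. f x + v x / 2 ^ Suc n)"
        using hits_dyadics_refine[OF assms(1,2) S(1), of n f] S(3) by blast
      then show ?thesis
        unfolding Q_def R_def by blast
    qed
  qed
  then obtain F where F: "\<And>n. Q n (F n)" "\<And>n. R n (F n) (F (Suc n))"
    by blast
  have F0: "F 0 = (\<lambda>_. 0)"
    using F(1)[of 0] by (simp add: Q_def)
  have "\<forall>n. \<exists>v. continuous_map Z euclideanreal v \<and> (\<forall>x. v x \<in> {0..1}) \<and>
      F (Suc n) = (\<lambda>x. F n x + v x / 2 ^ Suc n)"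
    using F(2) by (simp add: R_def)
  from choice[OF this] obtain v
    where v: "\<And>n. continuous_map Z euclideanreal (v n)" "\<And>n x. v n x \<in> {0..1}"
      "\<And>n. F (Suc n) = (\<lambda>x. F n x + v n x / 2 ^ Suc n)"
    by blast
  have sumF: "F n x = (\<Sum>i<n. v i x / 2 ^ Suc i)" for n x
    by (induction n) (auto simp: F0 v(3))
  have bound: "\<bar>v n x / 2 ^ Suc n\<bar> \<le> (1/2) ^ Suc n" for n x
    using v(2)[of n x] by (simp add: field_simps)
  have sm: "summable (\<lambda>n. (1/2::real) ^ Suc n)"
    using power_half_series sums_summable by blast
  define f where "f x = (\<Sum>n. v n x / 2 ^ Suc n)" for x
  have cont: "continuous_map Z euclideanreal f"
    unfolding f_def
    by (rule continuous_map_suminf[OF _ bound sm]) (intro continuous_intros v(1), auto)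
  have dist: "\<bar>f x - F n x\<bar> \<le> (1/2) ^ n" for n x
  proof -
    have s: "summable (\<lambda>n. v n x / 2 ^ Suc n)"
      by (rule summable_comparison_test'[OF sm]) (use bound in auto)
    have "f x - F n x = (\<Sum>i. v (i + n) x / 2 ^ Suc (i + n))"
      using suminf_minus_initial_segment[OF s, of n] by (simp add: f_def sumF)
    also have "\<bar>\<dots>\<bar> \<le> (\<Sum>i. (1/2) ^ n * (1/2::real) ^ Suc i)"
    proof -
      have "summable (\<lambda>i. (1/2) ^ n * (1/2::real) ^ Suc i)"
        using sm by (rule summable_mult)
      then have "norm (\<Sum>i. v (i + n) x / 2 ^ Suc (i + n)) \<le> (\<Sum>i. (1/2) ^ n * (1/2::real) ^ Suc i)"
        using bound[of "_ + n" x] by (intro norm_suminf_le) (simp_all add: power_add mult_ac)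
      then show ?thesis
        by simp
    qed
    also have "\<dots> = (1/2) ^ n"
      using suminf_mult[OF sm, of "(1/2) ^ n"] sums_unique[OF power_half_series] by simp
    finally show ?thesis .
  qed
  have "compactin euclideanreal (f ` topspace Z)"
    using assms(1) cont image_compactin unfolding compact_space_def by blast
  then have closed: "closed (f ` topspace Z)"
    by (simp add: compact_imp_closed)
  \<comment> \<open>For \<open>t < 1\<close> the floor of \<open>t * 2^n\<close> is below
    \<open>2^n\<close> and hence an admissible index; the endpoint 1 follows from closedness of the
    image.\<close>
  have "t \<in> closure (f ` topspace Z)" if t: "t \<in> {0..<1}" for t :: real
    unfolding closure_approachable
  proof (intro allI impI)
    fix e :: real assume "e > 0"
    then obtain n where n: "(1/2::real) ^ n < e / 2"
      using real_arch_pow_inv[of "e/2" "1/2"] by auto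
    define k where "k = nat \<lfloor>t * 2^n\<rfloor>"
    have k1: "real k \<le> t * 2^n" "t * 2^n < real k + 1"
      using t by (simp_all add: k_def)
    have "t * 2^n < 2^n"
      using t by simp
    then have "real k < 2^n"
      using k1 by linarith
    then have k: "k < 2^n"
      by simp
    obtain U where "openin Z U" "U \<inter> S \<noteq> {}" "\<And>x. x \<in> U \<Longrightarrow> F n x = real k / 2^n"
      using F(1)[of n] k unfolding Q_def hits_dyadics_def by meson
    then obtain x where x: "x \<in> topspace Z" "F n x = real k / 2^n"
      using S(1) by blast
    have "real k / 2^n \<le> t" "t \<le> real k / 2^n + (1/2) ^ n"
      using k1 by (simp_all add: field_simps)
    then have "\<bar>F n x - t\<bar> \<le> (1/2) ^ n"
      unfolding x(2) by (simp add: abs_if)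
    then have "dist (f x) t < e"
      using dist[of x n] n unfolding dist_real_def by linarith
    then show "\<exists>y\<in>f ` topspace Z. dist y t < e"
      using x by blast
  qed
  then have "{0..<1} \<subseteq> f ` topspace Z"
    using closed by (simp add: subset_iff)
  then have "{0..1} \<subseteq> f ` topspace Z"
    using closure_minimal[OF _ closed, of "{0..<1}"] by simp
  with cont show thesis
    using that by blast
qed

subsection \<open>Countable images of scattered compact spaces\<close>

text \<open>An isolated point \<open>z\<close> of the bad set \<open>S\<close> would have a closed
  neighbourhood \<open>V\<close> meeting \<open>S\<close> only in \<open>z\<close>. Away from the
  fibre of \<open>z\<close>, this \<open>V\<close> is a countable union of closed sets missing
  \<open>S\<close>, so its image is countable, a contradiction.\<close>

proposition scattered_countable_image:
  fixes u :: "nat \<Rightarrow> 'a \<Rightarrow> real"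
  assumes "compact_space Z" "Hausdorff_space Z" "scattered_space Z"
    and u: "\<And>k. continuous_map Z euclideanreal (u k)"
  shows "countable ((\<lambda>z k. u k z) ` topspace Z)"
proof -
  let ?F = "\<lambda>z k. u k z"
  define S where "S = {z \<in> topspace Z. \<forall>W. openin Z W \<and> z \<in> W \<longrightarrow> uncountable (?F ` W)}"
  \<comment> \<open>Such a \<open>K\<close> is covered by finitely many open sets with countable
    image.\<close>
  have count: "countable (?F ` K)" if K: "closedin Z K" "K \<inter> S = {}" for K
  proof -
    have "compactin Z K"
      using assms(1) K(1) closedin_compact_space by blast
    moreover have "K \<subseteq> \<Union>{W. openin Z W \<and> countable (?F ` W)}"
      using closedin_subset[OF K(1)] K(2) unfolding S_def by blast
    ultimately obtain \<F> where \<F>: "finite \<F>" "\<F> \<subseteq> {W. openin Z W \<and> countable (?F ` W)}" "K \<subseteq> \<Union>\<F>"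
      using compactinD[of Z K "{W. openin Z W \<and> countable (?F ` W)}"] by auto
    then have "countable (\<Union>W\<in>\<F>. ?F ` W)"
      by (intro countable_UN) (auto intro: countable_finite)
    then show ?thesis
      using \<F>(3) by (elim countable_subset[rotated]) auto
  qed
  have "S = {}"
  proof (rule ccontr)
    assume "S \<noteq> {}"
    moreover have "S \<subseteq> topspace Z"
      by (auto simp: S_def)
    ultimately obtain z T where z: "z \<in> S" and T: "openin Z T" "{z} = T \<inter> S"
      using assms(3) unfolding scattered_space_def by (metis openin_subtopology)
    have "regular_space Z"
      using assms(1,2) compact_Hausdorff_imp_regular_space by blast
    then obtain U V where UV: "openin Z U" "closedin Z V" "z \<in> U" "U \<subseteq> V" "V \<subseteq> T"
      using T unfolding neighbourhood_base_of_closedin[symmetric] neighbourhood_base_of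
      by (metis Int_iff insertI1)
    \<comment> \<open>The weak inequality keeps \<open>V' k n\<close> closed while excluding
      \<open>z\<close>; together these sets exhaust \<open>V\<close> up to the points with the same
      image as \<open>z\<close>.\<close>
    define V' where "V' k n = V \<inter> {w \<in> topspace Z. u k w - u k z \<in> {t. inverse (real (Suc n)) \<le> \<bar>t\<bar>}}"
      for k n
    have "closedin Z (V' k n)" for k n
      unfolding V'_def
      by (intro closedin_Int UV closedin_continuous_map_preimage[of _ euclideanreal]
            continuous_map_diff u) (auto intro!: closed_Collect_le continuous_intros)
    moreover have "V' k n \<inter> S = {}" for k n
    proof -
      have "z \<notin> V' k n"
        by (simp add: V'_def)
      moreover have "V' k n \<inter> S \<subseteq> {z}"
        using UV(5) T(2) unfolding V'_def by blast
      ultimately show ?thesis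
        by blast
    qed
    ultimately have "countable (?F ` V' k n)" for k n
      by (rule count)
    then have "countable ({?F z} \<union> (\<Union>k. \<Union>n. ?F ` V' k n))"
      by simp
    moreover have "?F ` V \<subseteq> {?F z} \<union> (\<Union>k. \<Union>n. ?F ` V' k n)"
    proof
      fix y assume "y \<in> ?F ` V"
      then obtain w where w: "w \<in> V" "y = ?F w"
        by blast
      show "y \<in> {?F z} \<union> (\<Union>k. \<Union>n. ?F ` V' k n)"
      proof (cases "?F w = ?F z")
        case False
        then obtain k where "u k w - u k z \<noteq> 0"
          by (auto simp: fun_eq_iff)
        then obtain n where "inverse (real (Suc n)) < \<bar>u k w - u k z\<bar>"
          using reals_Archimedean[of "\<bar>u k w - u k z\<bar>"] by auto
        then have "w \<in> V' k n"
          using w(1) closedin_subset[OF UV(2)] by (auto simp: V'_def)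
        then show ?thesis
          using w(2) by blast
      qed (use w in auto)
    qed
    ultimately have "countable (?F ` U)"
      using UV(4) by (meson countable_subset image_mono)
    then show False
      using z UV(1,3) by (auto simp: S_def)
  qed
  then show ?thesis
    by (intro count) auto
qed


subsection \<open>The Stone--Cech compactification\<close>

lemma compact_space_stone_cech: "compact_space (stone_cech X)"
  unfolding stone_cech_def
proof (intro compact_space_subtopology closedin_compact_space)
  show "compact_space (unit_cube X)"
    by (auto simp: unit_cube_def compact_space_product_topology compact_space_subtopology)
qed simp

lemma Hausdorff_space_stone_cech: "Hausdorff_space (stone_cech X)"
  unfolding stone_cech_def unit_cube_def
  by (auto intro!: Hausdorff_space_subtopology simp: Hausdorff_space_product_topology)

lemma continuous_map_stone_cech_eval:
  assumes "f \<in> unit_functions X"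
  shows "continuous_map (stone_cech X) euclideanreal (\<lambda>p. p f)"
proof -
  have "continuous_map (unit_cube X) (top_of_set {0..1}) (\<lambda>p. p f)"
    unfolding unit_cube_def using assms continuous_map_product_projection
      [of f "unit_functions X" "\<lambda>_. top_of_set {0..1}"] by simp
  then show ?thesis
    unfolding stone_cech_def
    by (intro continuous_map_from_subtopology) (simp add: continuous_map_in_subtopology)
qed

text \<open>A name for the evaluation map written out inside \<open>stone_cech\<close>, the
  canonical map of a space into its compactification.\<close>

definition stone_cech_map :: "'a topology \<Rightarrow> 'a \<Rightarrow> ('a \<Rightarrow> real) \<Rightarrow> real" where
  "stone_cech_map X x = (\<lambda>f\<in>unit_functions X. f x)"

lemma topspace_stone_cech:
  "topspace (stone_cech X) = unit_cube X closure_of (stone_cech_map X ` topspace X)"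
  by (simp add: stone_cech_def stone_cech_map_def[abs_def] Int_absorb1[OF closure_of_subset_topspace])

lemma continuous_map_stone_cech_map: "continuous_map X (stone_cech X) (stone_cech_map X)"
proof -
  have c: "continuous_map X (unit_cube X) (stone_cech_map X)"
    unfolding unit_cube_def continuous_map_componentwise
    by (auto simp: stone_cech_map_def unit_functions_def)
  then have "stone_cech_map X ` topspace X \<subseteq> topspace (unit_cube X)"
    by (rule continuous_map_image_subset_topspace)
  then have "stone_cech_map X ` topspace X \<subseteq> topspace (stone_cech X)"
    unfolding topspace_stone_cech by (rule closure_of_subset)
  then show ?thesis
    using c by (auto simp: stone_cech_def continuous_map_in_subtopology
        topspace_subtopology_subset closure_of_subset_topspace)
qed

lemma stone_cech_dense:
  "stone_cech X closure_of (stone_cech_map X ` topspace X) = topspace (stone_cech X)"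
proof -
  have "stone_cech_map X ` topspace X \<subseteq> topspace (stone_cech X)"
    by (rule continuous_map_image_subset_topspace[OF continuous_map_stone_cech_map])
  then show ?thesis
    unfolding topspace_stone_cech
    by (simp add: stone_cech_def closure_of_subtopology stone_cech_map_def[abs_def] Int_absorb1)
qed

text \<open>The \<open>g k\<close> may be unbounded and need not extend to the compactification.
  Squeezed injectively into the unit interval they become coordinates of the cube, and coordinates
  are continuous on all of \<open>stone_cech X\<close>.\<close>

lemma stone_cech_scattered_countable_image:
  fixes g :: "nat \<Rightarrow> 'a \<Rightarrow> real"
  assumes "scattered_space (stone_cech X)"
    and g: "\<And>k. continuous_map X euclideanreal (g k)"
  shows "countable ((\<lambda>x k. g k x) ` topspace X)"
proof -
  define \<phi> where "\<phi> t = (1 + t / (1 + \<bar>t\<bar>)) / 2" for t :: real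
  \<comment> \<open>The restriction is there because \<open>unit_functions\<close> contains only
    extensional functions.\<close>
  define v where "v k = restrict (\<lambda>x. \<phi> (g k x)) (topspace X)" for k
  have inj: "inj \<phi>"
  proof (rule injI)
    fix s t assume "\<phi> s = \<phi> t"
    then have "s / (1 + \<bar>s\<bar>) = t / (1 + \<bar>t\<bar>)"
      unfolding \<phi>_def divide_cancel_right add_left_cancel by simp
    then show "s = t"
      by (simp only: real_shrink_eq)
  qed
  have range: "\<phi> t \<in> {0..1}" for t
    using abs_ge_self[of t] abs_ge_minus_self[of t] by (auto simp: \<phi>_def field_simps)
  have "continuous_map X euclideanreal (\<lambda>x. \<phi> (g k x))" for k
    unfolding \<phi>_def by (intro continuous_intros g) auto
  then have "continuous_map X euclideanreal (v k)" for k
    by (rule continuous_map_eq) (simp add: v_def)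
  then have v: "v k \<in> unit_functions X" for k
    using range by (auto simp: unit_functions_def continuous_map_in_subtopology v_def)
  have "countable ((\<lambda>p k. p (v k)) ` topspace (stone_cech X))"
    by (intro scattered_countable_image assms(1) compact_space_stone_cech
        Hausdorff_space_stone_cech continuous_map_stone_cech_eval v)
  moreover have "stone_cech_map X ` topspace X \<subseteq> topspace (stone_cech X)"
    by (rule continuous_map_image_subset_topspace[OF continuous_map_stone_cech_map])
  ultimately have "countable ((\<lambda>p k. p (v k)) ` stone_cech_map X ` topspace X)"
    by (meson countable_subset image_mono)
  \<comment> \<open>Undoing the squeezing coordinatewise recovers the original values
    \<open>g k x\<close>.\<close>
  then have "countable ((\<lambda>s k. inv \<phi> (s k)) ` (\<lambda>p k. p (v k)) ` stone_cech_map X ` topspace X)"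
    by (rule countable_image)
  moreover have "(\<lambda>s k. inv \<phi> (s k)) ` (\<lambda>p k. p (v k)) ` stone_cech_map X ` topspace X =
      (\<lambda>x k. g k x) ` topspace X"
    unfolding image_image
    by (rule image_cong) (use v inj in \<open>auto simp: stone_cech_map_def v_def\<close>)
  ultimately show ?thesis
    by simp
qed

text \<open>If \<open>f p\<close> were not attained on \<open>X\<close>, then the distance from
  \<open>f p\<close> would have a positive lower bound on \<open>X\<close>; by density the bound
  would persist at \<open>p\<close>, where the distance is 0.\<close>

lemma pseudocompact_image_stone_cech:
  assumes "pseudocompact_space X" and f: "continuous_map (stone_cech X) euclideanreal f"
  shows "f ` topspace (stone_cech X) = (f \<circ> stone_cech_map X) ` topspace X"
proof -
  let ?e = "stone_cech_map X"
  have e: "?e ` topspace X \<subseteq> topspace (stone_cech X)"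
    by (rule continuous_map_image_subset_topspace[OF continuous_map_stone_cech_map])
  have "f p \<in> (f \<circ> ?e) ` topspace X" if p: "p \<in> topspace (stone_cech X)" for p
  proof (rule ccontr)
    assume np: "f p \<notin> (f \<circ> ?e) ` topspace X"
    have "continuous_map X euclideanreal (f \<circ> ?e)"
      using continuous_map_stone_cech_map f by (rule continuous_map_compose)
    then have "continuous_map X euclideanreal (\<lambda>x. \<bar>f (?e x) - f p\<bar>)"
      by (auto intro!: continuous_intros simp: o_def)
    moreover have "\<bar>f (?e x) - f p\<bar> > 0" if "x \<in> topspace X" for x
    proof -
      have "f (?e x) \<noteq> f p"
        using np that by force
      then show ?thesis
        by simp
    qed
    ultimately obtain d where d: "d > 0" "\<And>x. x \<in> topspace X \<Longrightarrow> d \<le> \<bar>f (?e x) - f p\<bar>"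
      using pseudocompact_space_bounded_below[of X "\<lambda>x. \<bar>f (?e x) - f p\<bar>"] assms(1) by blast
    let ?C = "{q \<in> topspace (stone_cech X). f q - f p \<in> {t. d \<le> \<bar>t\<bar>}}"
    have "closedin (stone_cech X) ?C"
      by (intro closedin_continuous_map_preimage[of _ euclideanreal] continuous_map_diff f)
        (auto intro!: closed_Collect_le continuous_intros)
    then have "stone_cech X closure_of (?e ` topspace X) \<subseteq> ?C"
      using d(2) e by (intro closure_of_minimal) auto
    then show False
      using p d(1) by (auto simp: stone_cech_dense)
  qed
  with e show ?thesis
    by force
qed

subsection \<open>Pointwise limits of Baire-one functions\<close>

text \<open>Sequential closedness of the Baire-one functions in the full product. Convergence off
  \<open>topspace X\<close> is automatic for limits that vanish there, as all the functions
  do.\<close>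

definition baire1_limit_closed :: "'a topology \<Rightarrow> bool" where
  "baire1_limit_closed X \<longleftrightarrow>
     (\<forall>h l. range h \<subseteq> baire1_functions X \<and> (\<forall>x. (\<lambda>n::nat. h n x) \<longlonglongrightarrow> l x) \<longrightarrow>
        l \<in> baire1_functions X)"

lemma baire1_limit_closedD:
  assumes "baire1_limit_closed X" "\<And>n. h n \<in> baire1_functions X" "\<And>x. (\<lambda>n. h n x) \<longlonglongrightarrow> l x"
  shows "l \<in> baire1_functions X"
  using assms unfolding baire1_limit_closed_def by blast

text \<open>Newton interpolation, adding one node at a time. That \<open>p\<close> factors through
  the family lets agreement at one node spread to its whole fibre.\<close>

lemma interpolation_through_family:
  fixes g :: "'i \<Rightarrow> 'a \<Rightarrow> real"
  assumes g: "\<And>k. continuous_map X euclideanreal (g k)" and "finite A"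
    and h: "\<And>x y. x \<in> A \<Longrightarrow> y \<in> A \<Longrightarrow> (\<And>k. g k x = g k y) \<Longrightarrow> h x = h y"
  shows "\<exists>p. continuous_map X euclideanreal p \<and> (\<forall>x y. (\<forall>k. g k x = g k y) \<longrightarrow> p x = p y) \<and>
           (\<forall>a\<in>A. p a = (h a :: real))"
  using assms(2) h
proof (induction A rule: finite_induct)
  case empty
  then show ?case
    by (intro exI[of _ "\<lambda>_. 0"]) auto
next
  case (insert a A)
  have "\<exists>p. continuous_map X euclideanreal p \<and> (\<forall>x y. (\<forall>k. g k x = g k y) \<longrightarrow> p x = p y) \<and>
      (\<forall>a\<in>A. p a = h a)"
    by (rule insert.IH, rule insert.prems) auto
  then obtain p where p: "continuous_map X euclideanreal p"
      "\<forall>x y. (\<forall>k. g k x = g k y) \<longrightarrow> p x = p y" "\<forall>b\<in>A. p b = h b"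
    by (elim exE conjE)
  show ?case
  proof (cases "\<exists>b\<in>A. \<forall>k. g k a = g k b")
    case True
    then obtain b where b: "b \<in> A" "\<And>k. g k a = g k b"
      by blast
    have "p a = p b"
      using p(2) b(2) by blast
    also have "p b = h b"
      using p(3) b(1) by blast
    also have "h b = h a"
      using insert.prems[OF _ _ b(2)] b(1) by simp
    finally show ?thesis
      using p by (intro exI[of _ p]) simp
  next
    case False
    then have "\<forall>b. \<exists>k. b \<in> A \<longrightarrow> g k a \<noteq> g k b"
      by blast
    from choice[OF this] obtain k where k: "\<And>b. b \<in> A \<Longrightarrow> g (k b) a \<noteq> g (k b) b"
      by blast
    \<comment> \<open>The Newton factor: each old node contributes a difference in a coordinate that
      separates it from \<open>a\<close>, so \<open>q\<close> vanishes at the old nodes but not at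
      \<open>a\<close>.\<close>
    define q where "q x = (\<Prod>b\<in>A. g (k b) x - g (k b) b)" for x
    have q: "q a \<noteq> 0" "\<And>b. b \<in> A \<Longrightarrow> q b = 0"
      using k insert.hyps(1) by (auto simp: q_def)
    define p' where "p' x = p x + (h a - p a) / q a * q x" for x
    have "continuous_map X euclideanreal p'"
      unfolding p'_def q_def using insert.hyps(1) by (intro continuous_intros p(1) g) auto
    moreover have "\<forall>x y. (\<forall>k. g k x = g k y) \<longrightarrow> p' x = p' y"
    proof (intro allI impI)
      fix x y assume xy: "\<forall>k. g k x = g k y"
      then have "p x = p y"
        using p(2) by blast
      moreover have "q x = q y"
        unfolding q_def by (rule prod.cong) (use xy in simp_all)
      ultimately show "p' x = p' y"
        by (simp add: p'_def)
    qed
    moreover have "\<forall>b\<in>insert a A. p' b = h b"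
      using q p(3) by (auto simp: p'_def)
    ultimately show ?thesis
      by blast
  qed
qed

text \<open>The limit \<open>l\<close> is constant on the fibres of the countably many approximating
  functions. There are countably many fibres, so interpolating \<open>l\<close> at the first
  \<open>n\<close> representatives gives functions that are eventually equal to \<open>l\<close> at
  each point.\<close>

proposition countable_images_imp_limit_closed:
  assumes countable: "\<And>g :: nat \<Rightarrow> 'a \<Rightarrow> real. (\<And>k. continuous_map X euclideanreal (g k)) \<Longrightarrow>
      countable ((\<lambda>x k. g k x) ` topspace X)"
  shows "baire1_limit_closed X"
  unfolding baire1_limit_closed_def
proof (intro allI impI, elim conjE)
  fix h :: "nat \<Rightarrow> 'a \<Rightarrow> real" and l
  assume h: "range h \<subseteq> baire1_functions X" and lim: "\<forall>x. (\<lambda>n. h n x) \<longlonglongrightarrow> l x"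
  have "\<forall>n. \<exists>g. (\<forall>m. continuous_map X euclideanreal (g m)) \<and>
      (\<forall>x\<in>topspace X. (\<lambda>m::nat. g m x) \<longlonglongrightarrow> h n x)"
    using h by (auto simp: baire1_functions_def)
  from choice[OF this] obtain g :: "nat \<Rightarrow> nat \<Rightarrow> 'a \<Rightarrow> real"
    where g: "\<And>n m. continuous_map X euclideanreal (g n m)"
      "\<And>n x. x \<in> topspace X \<Longrightarrow> (\<lambda>m. g n m x) \<longlonglongrightarrow> h n x"
    by blast
  \<comment> \<open>The double sequence of approximants is flattened to a single one, the form in
    which \<open>countable\<close> applies.\<close>
  define G where "G k = (case prod_decode k of (n, m) \<Rightarrow> g n m)" for k
  have G: "continuous_map X euclideanreal (G k)" for k
    using g(1) by (simp add: G_def split: prod.split)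
  have Gg: "g n m = G (prod_encode (n, m))" for n m
    by (simp add: G_def)
  have factor: "l x = l y" if "x \<in> topspace X" "y \<in> topspace X" "\<And>k. G k x = G k y" for x y
  proof -
    have "h n x = h n y" for n
      using g(2)[OF that(1), of n] g(2)[OF that(2), of n] that(3)
      by (simp add: Gg LIMSEQ_unique)
    then show ?thesis
      using LIMSEQ_unique[OF lim[rule_format, of x], of "l y"] lim by simp
  qed
  have zero: "l x = 0" if x: "x \<notin> topspace X" for x
  proof -
    have "h n x = 0" for n
      using h x by (auto simp: baire1_functions_def)
    then show ?thesis
      using lim[rule_format, of x] by (simp add: LIMSEQ_const_iff)
  qed
  show "l \<in> baire1_functions X"
  proof (cases "topspace X = {}")
    case True
    then show ?thesis
      using zero by (auto simp: baire1_functions_def intro!: exI[of _ "\<lambda>_ _. 0"])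
  next
    case False
    let ?Y = "(\<lambda>x k. G k x) ` topspace X"
    have Y: "countable ?Y" "?Y \<noteq> {}"
      using countable[OF G] False by auto
    \<comment> \<open>One representative is picked per enumerated value; repetitions in the
      enumeration, as for a finite image, do no harm.\<close>
    have "\<forall>i. \<exists>x. x \<in> topspace X \<and> (\<lambda>k. G k x) = from_nat_into ?Y i"
    proof
      fix i
      show "\<exists>x. x \<in> topspace X \<and> (\<lambda>k. G k x) = from_nat_into ?Y i"
        using from_nat_into[OF Y(2), of i] unfolding image_iff by (metis (lifting))
    qed
    from choice[OF this] obtain a
      where a: "\<And>i. a i \<in> topspace X" "\<And>i. (\<lambda>k. G k (a i)) = from_nat_into ?Y i"
      by blast
    have cover: "\<exists>i. \<forall>k. G k x = G k (a i)" if x: "x \<in> topspace X" for x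
    proof -
      have "(\<lambda>k. G k x) \<in> ?Y"
        using x by blast
      then obtain i where "from_nat_into ?Y i = (\<lambda>k. G k x)"
        using from_nat_into_surj[OF Y(1)] by blast
      then show ?thesis
        using a(2)[of i] by (intro exI[of _ i]) (auto simp: fun_eq_iff)
    qed
    have "\<forall>n. \<exists>p. continuous_map X euclideanreal p \<and> (\<forall>x y. (\<forall>k. G k x = G k y) \<longrightarrow> p x = p y) \<and>
           (\<forall>b\<in>a ` {..<n}. p b = l b)"
      by (intro allI interpolation_through_family[OF G] factor) (use a(1) in auto)
    from choice[OF this] obtain p where p: "\<forall>n. continuous_map X euclideanreal (p n) \<and>
        (\<forall>x y. (\<forall>k. G k x = G k y) \<longrightarrow> p n x = p n y) \<and> (\<forall>b\<in>a ` {..<n}. p n b = l b)"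
      by (elim exE)
    have "(\<lambda>n. p n x) \<longlonglongrightarrow> l x" if x: "x \<in> topspace X" for x
    proof -
      obtain i where i: "\<forall>k. G k x = G k (a i)"
        using cover[OF x] by blast
      have "p n x = l x" if "i < n" for n
      proof -
        have "p n x = p n (a i)"
          using p i by blast
        also have "\<dots> = l (a i)"
          using p that by blast
        also have "\<dots> = l x"
          using factor[OF x a(1)] i by simp
        finally show ?thesis .
      qed
      then show ?thesis
        by (intro tendsto_eventually) (auto simp: eventually_sequentially intro!: exI[of _ "Suc i"])
    qed
    then show ?thesis
      using p zero by (auto simp: baire1_functions_def)
  qed
qed

section \<open>Convergence and Cauchy sequences in the space of Baire-one functions\<close>

lemma limitin_baire1_space:
  "limitin (baire1_space X) s l F \<longleftrightarrow>
     l \<in> baire1_functions X \<and> (\<forall>\<^sub>F a in F. s a \<in> baire1_functions X) \<and> (\<forall>x. ((\<lambda>a. s a x) \<longlongrightarrow> l x) F)"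
  by (auto simp: baire1_space_def limitin_subtopology limitin_componentwise)

lemma openin_baire1_ball:
  "openin (baire1_space X) {f \<in> baire1_functions X. \<bar>f x\<bar> < e}"
proof -
  have "continuous_map (baire1_space X) euclideanreal (\<lambda>f. f x)"
    unfolding baire1_space_def
    by (intro continuous_map_from_subtopology continuous_map_product_projection) simp
  moreover have "open {t::real. \<bar>t\<bar> < e}"
    by (intro open_Collect_less continuous_intros)
  ultimately show ?thesis
    using openin_continuous_map_preimage[of "baire1_space X" euclideanreal _ "{t. \<bar>t\<bar> < e}"] by simp
qed

text \<open>Cauchy sequences here are the pointwise Cauchy ones. They always have a pointwise limit,
  and the only question is whether it is Baire-one.\<close>

lemma sequentially_complete_iff_limit_closed:
  "sequentially_complete (baire1_space X) \<longleftrightarrow> baire1_limit_closed X"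
proof
  assume sc: "sequentially_complete (baire1_space X)"
  show "baire1_limit_closed X"
    unfolding baire1_limit_closed_def
  proof (intro allI impI, elim conjE)
    fix h :: "nat \<Rightarrow> 'a \<Rightarrow> real" and l
    assume h: "range h \<subseteq> baire1_functions X" and lim: "\<forall>x. (\<lambda>n. h n x) \<longlonglongrightarrow> l x"
    let ?F = "sequentially \<times>\<^sub>F sequentially"
    have "((\<lambda>(n, m). (h m - h n) x) \<longlongrightarrow> l x - l x) ?F" for x
      unfolding case_prod_unfold minus_apply
      by (intro tendsto_diff filterlim_compose[OF lim[rule_format, of x]] filterlim_fst filterlim_snd)
    moreover have "h m - h n \<in> baire1_functions X" for m n
      by (rule subspace_diff[OF subspace_baire1_functions]) (use h in auto)
    moreover have "0 \<in> baire1_functions X"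
      by (rule subspace_0[OF subspace_baire1_functions])
    \<comment> \<open>The Cauchy property is obtained as convergence of the differences to 0 along
      the product filter.\<close>
    ultimately have "limitin (baire1_space X) (\<lambda>(n, m). h m - h n) 0 ?F"
      by (simp add: limitin_baire1_space case_prod_unfold)
    then have "cauchy_seq_in (baire1_space X) h"
      using h unfolding cauchy_seq_in_def limitin_def
      by (auto simp: eventually_prod_sequentially)
    then obtain l' where "limitin (baire1_space X) h l' sequentially"
      using sc by (auto simp: sequentially_complete_def)
    then have l': "l' \<in> baire1_functions X" "\<And>x. (\<lambda>n. h n x) \<longlonglongrightarrow> l' x"
      by (auto simp: limitin_baire1_space)
    have "l = l'"
      using lim l'(2) LIMSEQ_unique by blast
    with l'(1) show "l \<in> baire1_functions X"
      by simp
  qed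
next
  assume lc: "baire1_limit_closed X"
  show "sequentially_complete (baire1_space X)"
    unfolding sequentially_complete_def
  proof (intro allI impI)
    fix s assume s: "cauchy_seq_in (baire1_space X) s"
    have sB: "s n \<in> baire1_functions X" for n
      using s by (auto simp: cauchy_seq_in_def)
    have "convergent (\<lambda>n. s n x)" for x
      unfolding Cauchy_convergent_iff[symmetric]
    proof (rule CauchyI)
      fix e :: real assume "e > 0"
      then have "0 \<in> {f \<in> baire1_functions X. \<bar>f x\<bar> < e}"
        using subspace_0[OF subspace_baire1_functions[of X]] by simp
      then obtain N where "\<forall>m\<ge>N. \<forall>n\<ge>N. s m - s n \<in> {f \<in> baire1_functions X. \<bar>f x\<bar> < e}"
        using s openin_baire1_ball[of X x e] unfolding cauchy_seq_in_def by blast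
      then show "\<exists>M. \<forall>m\<ge>M. \<forall>n\<ge>M. norm (s m x - s n x) < e"
        by auto
    qed
    then have lim: "(\<lambda>n. s n x) \<longlonglongrightarrow> lim (\<lambda>n. s n x)" for x
      by (simp add: convergent_LIMSEQ_iff)
    then have "limitin (baire1_space X) s (\<lambda>x. lim (\<lambda>n. s n x)) sequentially"
      using baire1_limit_closedD[OF lc sB lim] sB by (simp add: limitin_baire1_space)
    then show "\<exists>l. limitin (baire1_space X) s l sequentially"
      by blast
  qed
qed

subsection \<open>Limit-closed spaces of Baire-one functions are locally complete\<close>

text \<open>The closed unit ball of l^1. Bounding partial sums uses finitely many coordinates at a
  time, which makes the set visibly closed in the product topology.\<close>

definition l1_ball :: "(nat \<Rightarrow> real) set" where
  "l1_ball = {a. \<forall>N. (\<Sum>i<N. \<bar>a i\<bar>) \<le> 1}"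

lemma l1_ball_summable: "a \<in> l1_ball \<Longrightarrow> summable (\<lambda>i. \<bar>a i\<bar>)"
  by (intro summableI_nonneg_bounded[of _ 1]) (auto simp: l1_ball_def)

lemma l1_ball_abs_le:
  assumes "a \<in> l1_ball"
  shows "\<bar>a i\<bar> \<le> 1"
proof -
  have "\<bar>a i\<bar> \<le> (\<Sum>j<Suc i. \<bar>a j\<bar>)"
    by (rule member_le_sum) auto
  also have "\<dots> \<le> 1"
    using assms unfolding l1_ball_def by blast
  finally show ?thesis .
qed

lemma l1_ball_summable_mult:
  assumes a: "a \<in> l1_ball" and c: "c \<longlonglongrightarrow> (0::real)"
  shows "summable (\<lambda>i. a i * c i)"
proof -
  obtain B where B: "\<And>i. \<bar>c i\<bar> \<le> B"
    using convergent_imp_Bseq[OF convergentI[OF c]] unfolding Bseq_def by auto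
  show ?thesis
  proof (rule summable_comparison_test')
    show "summable (\<lambda>i. \<bar>a i\<bar> * B)"
      using l1_ball_summable[OF a] by (rule summable_mult2)
    show "norm (a i * c i) \<le> \<bar>a i\<bar> * B" for i
      by (simp add: abs_mult mult_left_mono B)
  qed
qed

text \<open>The bound does not depend on \<open>a\<close>; this uniformity yields the continuity of
  the pairing with a null sequence.\<close>

lemma l1_ball_tail:
  assumes a: "a \<in> l1_ball" and c: "c \<longlonglongrightarrow> 0" and e: "\<And>i. N \<le> i \<Longrightarrow> \<bar>c i\<bar> \<le> e"
  shows "\<bar>(\<Sum>i. a i * c i) - (\<Sum>i<N. a i * c i)\<bar> \<le> e"
proof -
  have e0: "0 \<le> e"
    using e[of N] by (simp add: order_trans[OF abs_ge_zero])
  have sm: "summable (\<lambda>i. \<bar>a (i + N)\<bar>)"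
    using l1_ball_summable[OF a] by (rule summable_ignore_initial_segment)
  have "(\<Sum>i<n. \<bar>a (i + N)\<bar>) \<le> 1" for n
  proof -
    have "(\<Sum>i<n. \<bar>a (i + N)\<bar>) = (\<Sum>i\<in>{N..<n + N}. \<bar>a i\<bar>)"
      using sum.shift_bounds_nat_ivl[of "\<lambda>i. \<bar>a i\<bar>" 0 N n] by (simp add: atLeast0LessThan)
    also have "\<dots> \<le> (\<Sum>i<n + N. \<bar>a i\<bar>)"
      by (rule sum_mono2) auto
    also have "\<dots> \<le> 1"
      using a unfolding l1_ball_def by blast
    finally show ?thesis .
  qed
  then have le1: "(\<Sum>i. \<bar>a (i + N)\<bar>) \<le> 1"
    by (rule suminf_le_const[OF sm])
  have "\<bar>\<Sum>i. a (i + N) * c (i + N)\<bar> \<le> (\<Sum>i. \<bar>a (i + N)\<bar> * e)"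
    unfolding real_norm_def[symmetric]
  proof (rule norm_suminf_le)
    show "norm (a (i + N) * c (i + N)) \<le> norm (a (i + N)) * e" for i
      using e[of "i + N"] by (simp add: abs_mult mult_left_mono)
    show "summable (\<lambda>i. norm (a (i + N)) * e)"
      using sm by (simp add: summable_mult2)
  qed
  also have "\<dots> = (\<Sum>i. \<bar>a (i + N)\<bar>) * e"
    using suminf_mult2[OF sm, of e] by simp
  also have "\<dots> \<le> e"
    using mult_right_mono[OF le1 e0] by simp
  finally show ?thesis
    using suminf_minus_initial_segment[OF l1_ball_summable_mult[OF a c], of N] by simp
qed

lemma continuous_map_l1_ball_pairing:
  assumes c: "c \<longlonglongrightarrow> 0"
  shows "continuous_map (subtopology (powertop_real UNIV) l1_ball) euclideanreal (\<lambda>a. \<Sum>i. a i * c i)"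
proof -
  let ?X = "subtopology (powertop_real UNIV) l1_ball"
  have "continuous_map ?X Met_TC.mtopology (\<lambda>a. \<Sum>i. a i * c i)"
  proof (rule Met_TC.continuous_map_uniform_limit)
    have "continuous_map ?X euclideanreal (\<lambda>a. \<Sum>i<n. a i * c i)" for n
      by (intro continuous_intros continuous_map_from_subtopology) auto
    then show "\<forall>\<^sub>F n in sequentially. continuous_map ?X Met_TC.mtopology (\<lambda>a. \<Sum>i<n. a i * c i)"
      by simp
    fix e :: real assume e: "e > 0"
    then obtain N where N: "\<And>i. i \<ge> N \<Longrightarrow> \<bar>c i\<bar> \<le> e / 2"
      using LIMSEQ_D[OF c, of "e / 2"] by force
    have "dist (\<Sum>i<n. a i * c i) (\<Sum>i. a i * c i) < e" if "n \<ge> N" "a \<in> l1_ball" for n a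
    proof -
      have "\<bar>(\<Sum>i. a i * c i) - (\<Sum>i<n. a i * c i)\<bar> \<le> e / 2"
        by (rule l1_ball_tail[OF that(2) c]) (use N that(1) in auto)
      then show ?thesis
        using e by (simp add: dist_real_def abs_minus_commute)
    qed
    then show "\<forall>\<^sub>F n in sequentially. \<forall>a\<in>topspace ?X. (\<Sum>i. a i * c i) \<in> UNIV \<and>
        dist (\<Sum>i<n. a i * c i) (\<Sum>i. a i * c i) < e"
      unfolding eventually_sequentially by auto
  qed simp
  then show ?thesis
    by simp
qed

text \<open>A closed subset of a power of \<open>{-1..1}\<close>, which is compact by
  Tychonoff.\<close>

lemma compactin_l1_ball: "compactin (powertop_real UNIV) l1_ball"
proof (rule closed_compactin)
  show "compactin (powertop_real UNIV) (Pi\<^sub>E UNIV (\<lambda>_::nat. {-1..1::real}))"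
    by (simp add: compactin_PiE)
  show "l1_ball \<subseteq> Pi\<^sub>E UNIV (\<lambda>_. {-1..1})"
    using l1_ball_abs_le by (force simp: abs_le_iff)
  define K where "K N = {a \<in> topspace (powertop_real UNIV). (\<Sum>i<N. \<bar>a i\<bar>) \<in> {..1::real}}"
    for N :: nat
  have "closedin (powertop_real UNIV) (K N)" for N
    unfolding K_def
    by (rule closedin_continuous_map_preimage[of _ euclideanreal]) (auto intro!: continuous_intros)
  then have "closedin (powertop_real UNIV) (\<Inter>N. K N)"
    by (intro closedin_Inter) auto
  also have "(\<Inter>N. K N) = l1_ball"
    by (auto simp: l1_ball_def K_def)
  finally show "closedin (powertop_real UNIV) l1_ball" .
qed

lemma l1_ball_absolutely_convex:
  assumes "a \<in> l1_ball" "b \<in> l1_ball" "\<bar>s\<bar> + \<bar>t\<bar> \<le> 1"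
  shows "(\<lambda>i. s * a i + t * b i) \<in> l1_ball"
  unfolding l1_ball_def
proof (intro CollectI allI)
  fix N
  have "(\<Sum>i<N. \<bar>s * a i + t * b i\<bar>) \<le> (\<Sum>i<N. \<bar>s\<bar> * \<bar>a i\<bar> + \<bar>t\<bar> * \<bar>b i\<bar>)"
    by (intro sum_mono) (metis abs_mult abs_triangle_ineq)
  also have "\<dots> = \<bar>s\<bar> * (\<Sum>i<N. \<bar>a i\<bar>) + \<bar>t\<bar> * (\<Sum>i<N. \<bar>b i\<bar>)"
    by (simp add: sum.distrib sum_distrib_left)
  also have "\<dots> \<le> \<bar>s\<bar> * 1 + \<bar>t\<bar> * 1"
    using assms(1,2) by (intro add_mono mult_left_mono) (auto simp: l1_ball_def)
  finally show "(\<Sum>i<N. \<bar>s * a i + t * b i\<bar>) \<le> 1"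
    using assms(3) by simp
qed

lemma baire1_lincomb:
  assumes "\<And>n. s n \<in> baire1_functions X"
  shows "(\<lambda>x. \<Sum>i<n::nat. a i * s i x) \<in> baire1_functions X"
proof (induction n)
  case 0
  show ?case
    using subspace_0[OF subspace_baire1_functions[of X]] by (simp add: zero_fun_def)
next
  case (Suc n)
  have "(\<lambda>x. \<Sum>i<Suc n. a i * s i x) = (\<lambda>x. \<Sum>i<n. a i * s i x) + a n *\<^sub>R s n"
    by (simp add: fun_eq_iff)
  then show ?case
    using Suc.IH assms subspace_baire1_functions[of X]
    by (simp add: subspace_add subspace_scale)
qed

text \<open>The map \<open>T\<close> from \<open>l1_ball\<close> is continuous for pointwise
  convergence. Its image is compact, absolutely convex and contains the sequence, hence also the
  closed hull.\<close>

proposition limit_closed_imp_locally_complete: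
  assumes lc: "baire1_limit_closed X"
  shows "locally_complete (baire1_space X)"
  unfolding locally_complete_def
proof (intro allI impI, elim conjE)
  fix s :: "nat \<Rightarrow> 'a \<Rightarrow> real"
  assume s: "range s \<subseteq> topspace (baire1_space X)" and "limitin (baire1_space X) s 0 sequentially"
  then have lim: "\<And>x. (\<lambda>n. s n x) \<longlonglongrightarrow> 0" and sB: "\<And>n. s n \<in> baire1_functions X"
    by (auto simp: limitin_baire1_space)
  define T where "T a x = (\<Sum>i. a i * s i x)" for a :: "nat \<Rightarrow> real" and x
  have sums: "summable (\<lambda>i. a i * s i x)" if "a \<in> l1_ball" for a x
    using that lim by (rule l1_ball_summable_mult)
  have "continuous_map (subtopology (powertop_real UNIV) l1_ball) (powertop_real UNIV) T"
    unfolding continuous_map_componentwise_UNIV T_def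
    using continuous_map_l1_ball_pairing lim by blast
  moreover have "compactin (subtopology (powertop_real UNIV) l1_ball) l1_ball"
    using compactin_l1_ball by (simp add: compactin_subtopology)
  ultimately have "compactin (powertop_real UNIV) (T ` l1_ball)"
    by (rule image_compactin[rotated])
  \<comment> \<open>Closedness under limits enters here: \<open>T a\<close> is the pointwise limit
    of finite linear combinations.\<close>
  moreover have "T ` l1_ball \<subseteq> baire1_functions X"
  proof (rule image_subsetI)
    fix a assume a: "a \<in> l1_ball"
    show "T a \<in> baire1_functions X"
    proof (rule baire1_limit_closedD[OF lc])
      show "(\<lambda>x. \<Sum>i<n. a i * s i x) \<in> baire1_functions X" for n
        using sB by (rule baire1_lincomb)
      show "(\<lambda>n. \<Sum>i<n. a i * s i x) \<longlonglongrightarrow> T a x" for x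
        using summable_LIMSEQ[OF sums[OF a]] by (simp add: T_def)
    qed
  qed
  ultimately have comp: "compactin (baire1_space X) (T ` l1_ball)"
    by (simp add: baire1_space_def compactin_subtopology)
  have "absolutely_convex (T ` l1_ball)"
    unfolding absolutely_convex_def
  proof (intro ballI allI impI)
    fix f g :: "'a \<Rightarrow> real" and \<alpha> \<beta> :: real
    assume "f \<in> T ` l1_ball" "g \<in> T ` l1_ball" and ab: "\<bar>\<alpha>\<bar> + \<bar>\<beta>\<bar> \<le> 1"
    then obtain a b where fg: "a \<in> l1_ball" "f = T a" "b \<in> l1_ball" "g = T b"
      by blast
    have "\<alpha> *\<^sub>R f + \<beta> *\<^sub>R g = T (\<lambda>i. \<alpha> * a i + \<beta> * b i)"
    proof
      fix x
      have "T (\<lambda>i. \<alpha> * a i + \<beta> * b i) x = (\<Sum>i. \<alpha> * (a i * s i x) + \<beta> * (b i * s i x))"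
        by (simp add: T_def algebra_simps)
      also have "\<dots> = \<alpha> * T a x + \<beta> * T b x"
        unfolding T_def using sums[OF fg(1), of x] sums[OF fg(3), of x]
        by (simp add: suminf_add[symmetric] suminf_mult summable_mult)
      finally show "(\<alpha> *\<^sub>R f + \<beta> *\<^sub>R g) x = T (\<lambda>i. \<alpha> * a i + \<beta> * b i) x"
        by (simp add: fg)
    qed
    then show "\<alpha> *\<^sub>R f + \<beta> *\<^sub>R g \<in> T ` l1_ball"
      using l1_ball_absolutely_convex[OF fg(1,3) ab] by blast
  qed
  moreover have "range s \<subseteq> T ` l1_ball"
  proof (rule image_subsetI)
    fix n
    have "(\<lambda>i. if i = n then 1 else 0) \<in> l1_ball"
      by (simp add: l1_ball_def if_distrib sum.delta cong: if_cong)
    moreover have "s n = T (\<lambda>i. if i = n then 1 else 0)"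
    proof
      fix x
      have "(\<lambda>i. (if i = n then 1 else 0) * s i x) = (\<lambda>i. if i = n then s i x else 0)"
        by auto
      then have "(\<lambda>i. (if i = n then 1 else 0) * s i x) sums s n x"
        using sums_single[of n "\<lambda>i. s i x"] by simp
      then show "s n x = T (\<lambda>i. if i = n then 1 else 0) x"
        by (simp add: T_def sums_unique)
    qed
    ultimately show "s n \<in> T ` l1_ball"
      by blast
  qed
  ultimately have "absolutely_convex hull (range s) \<subseteq> T ` l1_ball"
    by (intro hull_minimal)
  moreover have "closedin (baire1_space X) (T ` l1_ball)"
    using comp hausdorff_lcs_baire1_space[of X] by (simp add: compactin_imp_closedin hausdorff_lcs_def)
  ultimately have "baire1_space X closure_of (absolutely_convex hull (range s)) \<subseteq> T ` l1_ball"
    by (rule closure_of_minimal)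
  then show "compactin (baire1_space X) (baire1_space X closure_of (absolutely_convex hull (range s)))"
    using closed_compactin[OF comp] by simp
qed


subsection \<open>The preimage of a countable set under a continuous function\<close>

text \<open>Tent functions around the fibre, with slopes tending to infinity, converge to the scaled
  indicator.\<close>

lemma fiber_indicator_baire1:
  assumes f: "continuous_map X euclideanreal f"
  shows "(\<lambda>x. if x \<in> topspace X \<and> f x = q then c else 0) \<in> baire1_functions X"
proof -
  let ?g = "\<lambda>n x. c * max 0 (1 - real n * \<bar>f x - q\<bar>)"
  have "continuous_map X euclideanreal (?g n)" for n
    by (intro continuous_intros f) auto
  moreover have "(\<lambda>n. ?g n x) \<longlonglongrightarrow> (if x \<in> topspace X \<and> f x = q then c else 0)"
    if x: "x \<in> topspace X" for x
  proof (cases "f x = q")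
    case False
    then obtain N where N: "real N * \<bar>f x - q\<bar> > 1"
      using ex_less_of_nat_mult[of "\<bar>f x - q\<bar>" 1] by auto
    have "?g n x = 0" if "n \<ge> N" for n
    proof -
      have "real N * \<bar>f x - q\<bar> \<le> real n * \<bar>f x - q\<bar>"
        using that by (intro mult_right_mono) auto
      then show ?thesis
        using N by simp
    qed
    then show ?thesis
      using False by (intro tendsto_eventually) (auto simp: eventually_sequentially)
  qed (use x in simp)
  ultimately show ?thesis
    unfolding baire1_functions_def by (intro CollectI conjI exI[of _ ?g]) auto
qed

text \<open>Splitting off the first term writes the sum as half of \<open>s j\<close> plus half of a
  shifted sum of the same kind, so two-term combinations suffice; the offset \<open>j\<close>
  carries the shift through the induction.\<close>

lemma absolutely_convex_geometric_sum:
  assumes C: "absolutely_convex C" "\<And>n. s n \<in> C"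
  shows "(\<lambda>x. \<Sum>i<N. (1/2::real) ^ Suc i * s (i + j) x) \<in> C"
proof (induction N arbitrary: j)
  case 0
  have "\<bar>0::real\<bar> + \<bar>0\<bar> \<le> 1"
    by simp
  then have "0 *\<^sub>R s 0 + 0 *\<^sub>R s 0 \<in> C"
    using C unfolding absolutely_convex_def by blast
  moreover have "0 *\<^sub>R s 0 + 0 *\<^sub>R s 0 = (\<lambda>x. 0)"
    by (simp add: fun_eq_iff)
  ultimately show ?case
    by (simp only: lessThan_0 sum.empty)
next
  case (Suc N)
  have "(\<lambda>x. \<Sum>i<Suc N. (1/2::real) ^ Suc i * s (i + j) x) =
      (1/2) *\<^sub>R s j + (1/2) *\<^sub>R (\<lambda>x. \<Sum>i<N. (1/2::real) ^ Suc i * s (i + Suc j) x)"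
    by (simp add: fun_eq_iff sum.lessThan_Suc_shift sum_distrib_left ac_simps
        del: sum.lessThan_Suc)
  moreover have "\<bar>1/2::real\<bar> + \<bar>1/2\<bar> \<le> 1"
    by simp
  ultimately show ?case
    using C(1) C(2)[of j] Suc.IH[of "Suc j"] unfolding absolutely_convex_def by presburger
qed

text \<open>By injectivity of \<open>q\<close> each point lies in at most one fibre, so even the
  inflated indicators \<open>h n\<close> form a null sequence. The weights of the geometric sums
  cancel the factors \<open>2 ^ Suc n\<close>, and the sums converge to the wanted
  indicator.\<close>

proposition locally_complete_imp_countable_preimage:
  fixes q :: "nat \<Rightarrow> real"
  assumes lc: "locally_complete (baire1_space X)" and f: "continuous_map X euclideanreal f"
    and q: "inj q"
  shows "(\<lambda>x. if x \<in> topspace X \<and> f x \<in> range q then 1 else 0) \<in> baire1_functions X"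
    (is "?l \<in> _")
proof -
  let ?E = "baire1_space X"
  define h where "h n x = (if x \<in> topspace X \<and> f x = q n then 2 ^ Suc n else 0 :: real)" for n x
  \<comment> \<open>The summand \<open>0\<close> matches the offset of
    \<open>absolutely_convex_geometric_sum\<close>.\<close>
  define P where "P N x = (\<Sum>i<N. (1/2) ^ Suc i * h (i + 0) x)" for N x
  have hB: "h n \<in> baire1_functions X" for n
    unfolding h_def[abs_def] by (rule fiber_indicator_baire1[OF f])
  have zero: "h n x = 0" if "x \<notin> topspace X \<or> f x \<noteq> q n" for n x
    using that by (auto simp: h_def)
  have h0: "(\<lambda>n. h n x) \<longlonglongrightarrow> 0" for x
  proof (cases "\<exists>m. x \<in> topspace X \<and> f x = q m")
    case True
    then obtain m where m: "f x = q m"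
      by blast
    have "h n x = 0" if "n \<ge> Suc m" for n
      using that injD[OF q, of m n] by (intro zero) (auto simp: m)
    then show ?thesis
      by (intro tendsto_eventually) (auto simp: eventually_sequentially)
  next
    case False
    then have "h n x = 0" for n
      using zero by blast
    then show ?thesis
      by simp
  qed
  have P: "(\<lambda>N. P N x) \<longlonglongrightarrow> ?l x" for x
  proof (cases "\<exists>m. x \<in> topspace X \<and> f x = q m")
    case True
    then obtain m where m: "x \<in> topspace X" "f x = q m"
      by blast
    have "P N x = 1" if "N \<ge> Suc m" for N
    proof -
      have "P N x = (\<Sum>i<N. if i = m then 1 else 0)"
        unfolding P_def
      proof (rule sum.cong)
        show "(1/2) ^ Suc i * h (i + 0) x = (if i = m then 1 else 0)" for i
          using m injD[OF q, of m i] by (auto simp: h_def power_one_over)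
      qed simp
      then show ?thesis
        using that by simp
    qed
    then show ?thesis
      using m by (intro tendsto_eventually) (auto simp: eventually_sequentially)
  next
    case False
    then have "h n x = 0" for n
      using zero by blast
    then show ?thesis
      using False by (auto simp: P_def)
  qed
  let ?H = "absolutely_convex hull (range h)"
  let ?C = "?E closure_of ?H"
  have "limitin ?E h 0 sequentially"
    using hB h0 subspace_0[OF subspace_baire1_functions[of X]] by (simp add: limitin_baire1_space)
  then have "compactin ?E ?C"
    using lc hB unfolding locally_complete_def by (simp add: image_subset_iff)
  then have comp: "compactin (powertop_real UNIV) ?C" "?C \<subseteq> baire1_functions X"
    by (auto simp: baire1_space_def compactin_subtopology)
  \<comment> \<open>The closure was taken among Baire-one functions only. Compactness makes it
    closed in the full product, so it captures the limit \<open>?l\<close> before that is known to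
    be Baire-one.\<close>
  have clos: "closedin (powertop_real UNIV) ?C"
    using comp(1) by (intro compactin_imp_closedin) (simp_all add: Hausdorff_space_product_topology)
  have "P N \<in> ?H" for N
    unfolding hull_def
  proof (rule InterI)
    fix C assume "C \<in> {t. absolutely_convex t \<and> range h \<subseteq> t}"
    then show "P N \<in> C"
      unfolding P_def[abs_def] by (intro absolutely_convex_geometric_sum) auto
  qed
  moreover have "P N \<in> topspace ?E" for N
    using baire1_lincomb[of h X "\<lambda>i. (1/2) ^ Suc i" N] hB by (simp add: P_def[abs_def])
  ultimately have PC: "P N \<in> ?C" for N
    using closure_of_subset_Int[of ?E ?H] by blast
  have "limitin (powertop_real UNIV) P ?l sequentially"
    using P by (simp add: limitin_componentwise)
  then have "?l \<in> ?C"
    using clos PC unfolding limitin_def closedin_def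
    by (metis (no_types, lifting) Diff_iff eventually_happens trivial_limit_sequentially)
  then show ?thesis
    using comp(2) by blast
qed

section \<open>Baire category on the unit interval against local completeness\<close>

proposition not_locally_complete_if_onto:
  assumes pc: "pseudocompact_space X" and f: "continuous_map X euclideanreal f"
    and onto: "{0..1} \<subseteq> f ` topspace X"
  shows "\<not> locally_complete (baire1_space X)"
proof
  assume lc: "locally_complete (baire1_space X)"
  have inf: "infinite (\<rat> :: real set)"
    using Rats_infinite by blast
  define q where "q = from_nat_into (\<rat> :: real set)"
  have bij: "bij_betw q UNIV \<rat>"
    unfolding q_def by (rule bij_betw_from_nat_into[OF countable_rat inf])
  have "(\<lambda>x. if x \<in> topspace X \<and> f x \<in> range q then 1 else 0) \<in> baire1_functions X"
    using lc f bij by (intro locally_complete_imp_countable_preimage) (auto simp: bij_betw_def)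
  then obtain g :: "nat \<Rightarrow> 'a \<Rightarrow> real" where g: "\<And>n. continuous_map X euclideanreal (g n)"
      and lim: "\<And>x. x \<in> topspace X \<Longrightarrow> (\<lambda>n. g n x) \<longlonglongrightarrow> (if f x \<in> \<rat> then 1 else 0)"
    using bij unfolding baire1_functions_def bij_betw_def by auto
  \<comment> \<open>The sequence \<open>g\<close> tends to 1 over rationals and to 0 over
    irrationals, so staying below 1/2 from index \<open>n\<close> on excludes the former and
    eventually holds for the latter.\<close>
  define C where "C n = f ` {x \<in> topspace X. \<forall>k. g (k + n) x \<le> 1/2}" for n
  have C: "closed (C n)" for n
  proof -
    \<comment> \<open>The countably many conditions defining \<open>C n\<close> become one zero set:
      \<open>u k\<close> vanishes exactly where the \<open>k\<close>-th holds, and the cap makes the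
      sum of the \<open>u k\<close> continuous.\<close>
    define u where "u k x = min ((1/2) ^ k) (max 0 (g (k + n) x - 1/2))" for k x
    have bound: "\<bar>u k x\<bar> \<le> (1/2) ^ k" for k x
      by (auto simp: u_def)
    have cont: "continuous_map X euclideanreal (u k)" for k
      unfolding u_def by (intro continuous_intros g) auto
    have sm: "summable (\<lambda>k. u k x)" for x
      by (rule summable_comparison_test'[OF summable_geometric[of "1/2::real"]]) (use bound in auto)
    have nonneg: "0 \<le> u k x" for k x
      by (simp add: u_def)
    have "continuous_map X euclideanreal (\<lambda>x. \<Sum>k. u k x)"
      by (rule continuous_map_suminf[OF cont bound]) (simp add: summable_geometric)
    then have "closed (f ` {x \<in> topspace X. (\<Sum>k. u k x) = 0})"
      by (intro closed_image_zero_set[OF pc f]) (auto intro: suminf_nonneg sm nonneg)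
    also have "{x \<in> topspace X. (\<Sum>k. u k x) = 0} = {x \<in> topspace X. \<forall>k. g (k + n) x \<le> 1/2}"
    proof -
      have "(\<Sum>k. u k x) = 0 \<longleftrightarrow> (\<forall>k. g (k + n) x \<le> 1/2)" for x
      proof -
        have "u k x = 0 \<longleftrightarrow> g (k + n) x \<le> 1/2" for k
          using zero_less_power[of "1/2::real" k] unfolding u_def
          by linarith
        then show ?thesis
          using suminf_eq_zero_iff[OF sm[of x] nonneg] by simp
      qed
      then show ?thesis
        by simp
    qed
    finally show ?thesis
      by (simp add: C_def)
  qed
  have irr: "C n \<inter> \<rat> = {}" for n
  proof -
    have False if x: "x \<in> topspace X" "\<forall>k. g (k + n) x \<le> 1/2" "f x \<in> \<rat>" for x
    proof -
      have "(\<lambda>k. g (k + n) x) \<longlonglongrightarrow> 1"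
        using LIMSEQ_ignore_initial_segment[OF lim[OF x(1)], of n] x(3) by simp
      then have "1 \<le> (1/2::real)"
        by (rule LIMSEQ_le_const2) (use x(2) in auto)
      then show False
        by simp
    qed
    then show ?thesis
      by (auto simp: C_def)
  qed
  have cover: "\<exists>n. t \<in> C n" if t: "t \<in> {0..1}" "t \<notin> \<rat>" for t
  proof -
    obtain x where x: "x \<in> topspace X" "f x = t"
      using onto t(1) by blast
    have "(\<lambda>k. g k x) \<longlonglongrightarrow> 0"
      using lim[OF x(1)] x(2) t(2) by simp
    then obtain n where "\<forall>k\<ge>n. norm (g k x - 0) < 1/2"
      using LIMSEQ_D[of _ 0 "1/2"] by force
    then have small: "\<bar>g (k + n) x\<bar> < 1/2" for k
      by simp
    have "\<forall>k. g (k + n) x \<le> 1/2"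
    proof
      fix k
      show "g (k + n) x \<le> 1/2"
        using small[of k] by linarith
    qed
    with x show ?thesis
      unfolding C_def by blast
  qed
  \<comment> \<open>A set containing no open interval has dense complement in \<open>{0..1}\<close>;
    the \<open>max\<close> and \<open>min\<close> keep the approximating point inside.\<close>
  have dense_compl: "{0..1} \<subseteq> closure ({0..1} - F)"
    if F: "\<And>a b. a < b \<Longrightarrow> \<exists>d. d \<notin> F \<and> a < d \<and> d < b" for F :: "real set"
  proof
    fix t :: real assume t: "t \<in> {0..1}"
    show "t \<in> closure ({0..1} - F)"
      unfolding closure_approachable
    proof (intro allI impI)
      fix e :: real assume "e > 0"
      then have "max 0 (t - e) < min 1 (t + e)"
        using t by auto
      then obtain d where "d \<notin> F" "max 0 (t - e) < d" "d < min 1 (t + e)"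
        using F by blast
      then show "\<exists>y\<in>{0..1} - F. dist y t < e"
        by (intro bexI[of _ d]) (auto simp: dist_real_def)
    qed
  qed
  \<comment> \<open>The first family removes the irrationals of the interval, the second its
    rationals, so nothing remains; yet all members are open and dense in
    \<open>{0..1}\<close>.\<close>
  define \<G> where "\<G> = range (\<lambda>n. {0..1} - C n) \<union> (\<lambda>r. {0..1} - {r}) ` \<rat>"
  have "{0..1} \<subseteq> closure (\<Inter>\<G>)"
  proof (rule Baire)
    show "countable \<G>"
      unfolding \<G>_def by (intro countable_Un countable_image countable_rat) auto
    fix T assume "T \<in> \<G>"
    then obtain F where T: "T = {0..1} - F" and F: "(\<exists>n. F = C n) \<or> (\<exists>r. F = {r})"
      unfolding \<G>_def by blast
    have "closed F"
      using F C by auto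
    have gap: "\<exists>d. d \<notin> F \<and> a < d \<and> d < b" if ab: "a < b" for a b
      using F
    proof (elim disjE exE)
      fix n assume "F = C n"
      then show ?thesis
        using Rats_dense_in_real[OF ab] irr[of n] by blast
    next
      fix r assume r: "F = {r}"
      obtain c where c: "a < c" "c < b"
        using dense[OF ab] by blast
      obtain c' where c': "a < c'" "c' < c"
        using dense[OF c(1)] by blast
      show ?thesis
      proof (cases "c = r")
        case True
        then show ?thesis
          using c c' r by (intro exI[of _ c']) auto
      next
        case False
        then show ?thesis
          using c r by (intro exI[of _ c]) auto
      qed
    qed
    have "openin (top_of_set {0..1}) ({0..1} \<inter> - F)"
      using \<open>closed F\<close> by (intro openin_open_Int) auto
    then show "openin (top_of_set {0..1}) T \<and> {0..1} \<subseteq> closure T"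
      using dense_compl[OF gap] by (simp add: T Diff_eq)
  qed simp
  moreover have "\<Inter>\<G> = {}"
  proof -
    have "\<exists>T\<in>\<G>. t \<notin> T" for t
    proof (cases "t \<in> {0..1} \<and> t \<notin> \<rat>")
      case True
      then obtain n where "t \<in> C n"
        using cover by blast
      then show ?thesis
        by (intro bexI[of _ "{0..1} - C n"]) (auto simp: \<G>_def)
    next
      case False
      then consider "t \<notin> {0..1}" | "t \<in> \<rat>"
        by blast
      then show ?thesis
      proof cases
        case 1
        then have "t \<notin> {0..1} - C 0"
          by blast
        moreover have "{0..1} - C 0 \<in> \<G>"
          by (simp add: \<G>_def)
        ultimately show ?thesis
          by blast
      next
        case 2
        then show ?thesis
          by (intro bexI[of _ "{0..1} - {t}"]) (simp_all add: \<G>_def)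
      qed
    qed
    then show ?thesis
      by blast
  qed
  ultimately show False
    by simp
qed

theorem corollary3p5:
  fixes X :: "'a topology" and K :: "'b topology"
  shows "(tychonoff_space X \<and> pseudocompact_space X \<longrightarrow>
            (locally_complete (baire1_space X) \<longleftrightarrow> scattered_space (stone_cech X))) \<and>
         (compact_space K \<and> Hausdorff_space K \<longrightarrow>
            (locally_complete (baire1_space K) \<longleftrightarrow> sequentially_complete (baire1_space K)) \<and>
            (sequentially_complete (baire1_space K) \<longleftrightarrow> scattered_space K))"
proof (intro conjI impI; elim conjE)
  assume pc: "pseudocompact_space X"
  show "locally_complete (baire1_space X) \<longleftrightarrow> scattered_space (stone_cech X)"
  proof
    assume lc: "locally_complete (baire1_space X)"
    show "scattered_space (stone_cech X)"
    proof (rule ccontr)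
      assume "\<not> scattered_space (stone_cech X)"
      with compact_space_stone_cech Hausdorff_space_stone_cech
      obtain f :: "(('a \<Rightarrow> real) \<Rightarrow> real) \<Rightarrow> real"
        where f: "continuous_map (stone_cech X) euclideanreal f" "{0..1} \<subseteq> f ` topspace (stone_cech X)"
        by (rule non_scattered_onto_unit_interval)
      have "continuous_map X euclideanreal (f \<circ> stone_cech_map X)"
        using continuous_map_stone_cech_map f(1) by (rule continuous_map_compose)
      \<comment> \<open>Pseudocompactness brings the surjection from the compactification back to
        \<open>X\<close> without losing values.\<close>
      moreover have "{0..1} \<subseteq> (f \<circ> stone_cech_map X) ` topspace X"
        using f(2) unfolding pseudocompact_image_stone_cech[OF pc f(1)] .
      ultimately show False
        using not_locally_complete_if_onto[OF pc] lc by blast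
    qed
  next
    assume "scattered_space (stone_cech X)"
    then have "baire1_limit_closed X"
      by (intro countable_images_imp_limit_closed stone_cech_scattered_countable_image)
    then show "locally_complete (baire1_space X)"
      by (rule limit_closed_imp_locally_complete)
  qed
next
  assume K: "compact_space K" "Hausdorff_space K"
  \<comment> \<open>The three conditions are linked in a cycle, with the arguments applied to
    \<open>K\<close> itself instead of \<open>stone_cech K\<close>.\<close>
  have "sequentially_complete (baire1_space K) \<Longrightarrow> locally_complete (baire1_space K)"
    unfolding sequentially_complete_iff_limit_closed by (rule limit_closed_imp_locally_complete)
  moreover have "scattered_space K" if lc: "locally_complete (baire1_space K)"
  proof (rule ccontr)
    assume "\<not> scattered_space K"
    from K this obtain f :: "'b \<Rightarrow> real"
      where "continuous_map K euclideanreal f" "{0..1} \<subseteq> f ` topspace K"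
      by (rule non_scattered_onto_unit_interval)
    with compact_imp_pseudocompact_space[OF K(1)] have "\<not> locally_complete (baire1_space K)"
      by (rule not_locally_complete_if_onto)
    then show False
      using lc by contradiction
  qed
  moreover have "scattered_space K \<Longrightarrow> sequentially_complete (baire1_space K)"
    unfolding sequentially_complete_iff_limit_closed
    by (intro countable_images_imp_limit_closed scattered_countable_image K)
  ultimately show "locally_complete (baire1_space K) \<longleftrightarrow> sequentially_complete (baire1_space K)"
      "sequentially_complete (baire1_space K) \<longleftrightarrow> scattered_space K"
    by blast+
qed

end
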